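(* For every integer $n\ge 1$, with $a,b$ the two colors of $C_2$, $$\left|\Pi_n^{eq}\wr C_2(\{1^a1^b,1^a1^a\})\right|=\left|\Pi_n^{eq}\wr C_2(\{1^b1^a,1^a1^a\})\right|=\sum_{k=1}^n 2^k S(n,k).$$
   Context: $\Pi_n\wr C_2$ is the set of colored set partitions of $[n]$ with colors $a,b$ (a set partition of $[n]$ plus a color for each element). For colors $\gamma,\delta$, a colored partition eq-contains $1^\gamma1^\delta$ if some block contains elements $x<y$ with $x$ colored $\gamma$ and $y$ colored $\delta$. $\Pi_n^{eq}\wr C_2(R)$ is the set of colored partitions eq-containing no pattern in $R$. $S(n,k)$ is the Stirling number of the second kind. *)

theory Defs
  imports "HOL-Library.Disjoint_Sets" "HOL-Library.FuncSet" "HOL-Combinatorics.Stirling"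
begin

datatype color = Col_a | Col_b

type_synonym colored_partition = "nat set set \<times> (nat \<Rightarrow> color)"

text \<open>The coloring is extensional (fixed to \<open>undefined\<close> outside \<open>{1..n}\<close>), so that each
  coloring of \<open>{1..n}\<close> is represented exactly once.\<close>

definition colored_partitions :: "nat \<Rightarrow> colored_partition set" where
  "colored_partitions n =
     {(P, c). partition_on {1..n} P \<and> c \<in> {1..n} \<rightarrow>\<^sub>E UNIV}"

text \<open>The pair \<open>(\<gamma>, \<delta>)\<close> encodes the pattern with underlying set partition \<open>11\<close>, i.e.\ a single
  block \<open>{1, 2}\<close>, in which 1 has color \<open>\<gamma>\<close> and 2 has color \<open>\<delta>\<close>.\<close>

fun eq_contains :: "colored_partition \<Rightarrow> color \<times> color \<Rightarrow> bool" where
  "eq_contains (P, c) (\<gamma>, \<delta>) \<longleftrightarrow>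
     (\<exists>X\<in>P. \<exists>x\<in>X. \<exists>y\<in>X. x < y \<and> c x = \<gamma> \<and> c y = \<delta>)"

definition eq_avoiders :: "nat \<Rightarrow> (color \<times> color) set \<Rightarrow> colored_partition set" where
  "eq_avoiders n R = {p \<in> colored_partitions n. \<forall>r\<in>R. \<not> eq_contains p r}"

end

theory Submission
  imports Defs
begin

text \<open>Avoiding \<open>{1\<^sup>a1\<^sup>b, 1\<^sup>a1\<^sup>a}\<close> means that an element of color \<open>a\<close> is never followed by another
  element of its block, i.e.\ only block maxima may have color \<open>a\<close>; avoiding \<open>{1\<^sup>b1\<^sup>a, 1\<^sup>a1\<^sup>a}\<close> means
  the same for block minima. In both cases exactly one element of each block is free to take
  either color, so a partition with \<open>k\<close> blocks admits \<open>2 ^ k\<close> colorings.\<close>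

section \<open>Counting set partitions with a given number of blocks\<close>

definition partitions_with :: "'a set \<Rightarrow> nat \<Rightarrow> 'a set set set" where
  "partitions_with A k = {P. partition_on A P \<and> card P = k}"

lemma finite_partitions_with: "finite A \<Longrightarrow> finite (partitions_with A k)"
  unfolding partitions_with_def
  by (rule finite_subset[OF _ finitely_many_partition_on]) auto

lemma partition_on_disjointD:
  "partition_on A P \<Longrightarrow> X \<in> P \<Longrightarrow> Y \<in> P \<Longrightarrow> x \<in> X \<Longrightarrow> x \<in> Y \<Longrightarrow> X = Y"
  by (auto simp: partition_on_def disjoint_def)

lemma partition_on_insert_singleton:
  assumes "a \<notin> A" "partition_on A P"
  shows "partition_on (insert a A) (insert {a} P)"
  using assms unfolding partition_on_def disjoint_def by auto

lemma partition_on_Diff_singleton: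
  assumes "a \<notin> A" "partition_on (insert a A) P" "{a} \<in> P"
  shows "partition_on A (P - {{a}})"
proof (rule partition_onI)
  have dj: "X = {a}" if "X \<in> P" "a \<in> X" for X
    using partition_on_disjointD[OF assms(2) that(1) assms(3) that(2)] by simp
  have "insert a (\<Union>(P - {{a}})) = \<Union>P"
    using assms(3) by auto
  also have "\<dots> = insert a A"
    using assms(2) by (simp add: partition_on_def)
  finally have "insert a (\<Union>(P - {{a}})) = insert a A" .
  moreover have "a \<notin> \<Union>(P - {{a}})"
    using dj by auto
  ultimately show "\<Union>(P - {{a}}) = A"
    using assms(1) insert_ident[of a "\<Union>(P - {{a}})" A] by simp
  show "disjnt p q" if "p \<in> P - {{a}}" "q \<in> P - {{a}}" "p \<noteq> q" for p q
    using assms(2) that by (auto simp: partition_on_def disjoint_def disjnt_def)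
  show "{} \<notin> P - {{a}}"
    using assms(2) by (simp add: partition_on_def)
qed

definition add_to_block :: "'a \<Rightarrow> 'a set set \<Rightarrow> 'a set \<Rightarrow> 'a set set" where
  "add_to_block a Q X = insert (insert a X) (Q - {X})"

lemma partition_on_add_to_block:
  assumes "a \<notin> A" "partition_on A Q" "X \<in> Q"
  shows "partition_on (insert a A) (add_to_block a Q X)"
  using assms unfolding partition_on_def disjoint_def add_to_block_def by auto

text \<open>No block of \<open>Q\<close> contains \<open>a\<close>, so the enlarged block is new:
  one block leaves and one enters.\<close>

lemma card_add_to_block:
  assumes "finite A" "a \<notin> A" "partition_on A Q" "X \<in> Q"
  shows "card (add_to_block a Q X) = card Q"
proof -
  have "finite Q" using finite_elements[OF assms(1,3)] .
  moreover have "insert a X \<notin> Q"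
    using assms(2,3) by (auto simp: partition_on_def)
  ultimately have "card (add_to_block a Q X) = Suc (card (Q - {X}))"
    by (simp add: add_to_block_def)
  also have "\<dots> = card Q"
    using \<open>finite Q\<close> assms(4) by (rule card_Suc_Diff1)
  finally show ?thesis .
qed

text \<open>Both arguments can be read off the result: the only block containing \<open>a\<close> is
  \<open>insert a X\<close>, and the blocks without \<open>a\<close> form
  \<open>Q - {X}\<close>.\<close>

lemma add_to_block_inject:
  assumes "a \<notin> A" "partition_on A Q" "X \<in> Q" "partition_on A R" "Y \<in> R"
    and eq: "add_to_block a Q X = add_to_block a R Y"
  shows "Q = R \<and> X = Y"
proof -
  have nQ: "\<And>Z. Z \<in> Q \<Longrightarrow> a \<notin> Z" and nR: "\<And>Z. Z \<in> R \<Longrightarrow> a \<notin> Z"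
    using assms by (auto simp: partition_on_def)
  have "insert a X = insert a Y"
    using eq nR unfolding add_to_block_def by blast
  then have XY: "X = Y"
    using nQ[OF assms(3)] nR[OF assms(5)] by auto
  have "Q - {X} = {Z \<in> add_to_block a Q X. a \<notin> Z}"
    using nQ by (auto simp: add_to_block_def)
  moreover have "R - {Y} = {Z \<in> add_to_block a R Y. a \<notin> Z}"
    using nR by (auto simp: add_to_block_def)
  ultimately have "Q - {X} = R - {X}"
    using eq XY by simp
  then show ?thesis using assms(3,5) XY by blast
qed

text \<open>Since \<open>a\<close> is not alone in its block, deleting it leaves a nonempty block,
  and adding it back recovers \<open>P\<close>.\<close>

lemma add_to_block_surj:
  assumes "a \<notin> A" "partition_on (insert a A) P" "{a} \<notin> P"
  obtains Q X where "partition_on A Q" "X \<in> Q" "P = add_to_block a Q X"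
proof -
  obtain B where B: "B \<in> P" "a \<in> B"
    using assms(2) by (auto simp: partition_on_def)
  define X where "X = B - {a}"
  define Q where "Q = insert X (P - {B})"
  have dj: "\<And>x Y Z. Y \<in> P \<Longrightarrow> Z \<in> P \<Longrightarrow> x \<in> Y \<Longrightarrow> x \<in> Z \<Longrightarrow> Y = Z"
    using partition_on_disjointD[OF assms(2)] .
  have X: "X \<noteq> {}"
  proof
    assume "X = {}"
    then have "B = {a}" using B by (auto simp: X_def)
    then show False using B assms(3) by simp
  qed
  \<comment> \<open>If \<open>X\<close> were a block, it would meet \<open>B\<close> (being
    nonempty) and hence equal \<open>B\<close>, but \<open>a\<close> lies in \<open>B\<close> only.
    So replacing \<open>B\<close> by \<open>X\<close> merges nothing and is reversible.\<close>
  have XP: "X \<notin> P" using dj[of X B] B X by (auto simp: X_def)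
  have U: "\<Union>P = insert a A" using assms(2) by (simp add: partition_on_def)
  have "partition_on A Q"
  proof (rule partition_onI)
    show "\<Union>Q = A"
    proof
      have "a \<notin> Z" if "Z \<in> P - {B}" for Z using that dj[of Z B a] B by blast
      then have "a \<notin> \<Union>Q" by (auto simp: Q_def X_def)
      moreover have "\<Union>Q \<subseteq> \<Union>P" using B by (auto simp: Q_def X_def)
      ultimately show "\<Union>Q \<subseteq> A" using subset_insert[of a "\<Union>Q" A] U by simp
      show "A \<subseteq> \<Union>Q" using U assms(1) B by (auto simp: Q_def X_def)
    qed
    have X_dj: "disjnt X p" if "p \<in> P - {B}" for p
      using that dj[of p B] B(1) by (auto simp: X_def disjnt_def)
    show "disjnt p q" if pq: "p \<in> Q" "q \<in> Q" "p \<noteq> q" for p q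
    proof -
      consider "p = X" "q \<in> P - {B}" | "q = X" "p \<in> P - {B}" | "p \<in> P" "q \<in> P"
        using pq unfolding Q_def by blast
      then show ?thesis
      proof cases
        case 1
        then show ?thesis using X_dj by simp
      next
        case 2
        then show ?thesis using X_dj disjnt_sym by blast
      next
        case 3
        then show ?thesis using dj[of p q] pq(3) by (auto simp: disjnt_def)
      qed
    qed
    show "{} \<notin> Q"
      using X assms(2) by (simp add: Q_def partition_on_def)
  qed
  moreover have "X \<in> Q" by (simp add: Q_def)
  moreover have "P = add_to_block a Q X"
  proof -
    have "insert a X = B" using B by (auto simp: X_def)
    moreover have "Q - {X} = P - {B}" using XP by (auto simp: Q_def)
    ultimately show ?thesis using B by (auto simp: add_to_block_def)
  qed
  ultimately show thesis by (rule that)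
qed

text \<open>The set-level form of the Stirling recurrence: either \<open>a\<close> is a singleton
  block, or it joins a chosen block of a partition of \<open>A\<close> that already has
  \<open>Suc k\<close> blocks.\<close>

lemma partitions_with_insert_Suc:
  assumes "finite A" "a \<notin> A"
  shows "partitions_with (insert a A) (Suc k) =
    insert {a} ` partitions_with A k \<union>
    (\<lambda>(Q, X). add_to_block a Q X) ` (SIGMA Q : partitions_with A (Suc k). Q)" (is "?L = ?R")
proof
  show "?L \<subseteq> ?R"
  proof
    fix P assume "P \<in> ?L"
    then have P: "partition_on (insert a A) P" "card P = Suc k"
      by (auto simp: partitions_with_def)
    show "P \<in> ?R"
    proof (cases "{a} \<in> P")
      case True
      then have "P - {{a}} \<in> partitions_with A k" "P = insert {a} (P - {{a}})"
        using P partition_on_Diff_singleton[OF assms(2) P(1)] by (auto simp: partitions_with_def)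
      then show ?thesis by blast
    next
      case False
      then obtain Q X where "partition_on A Q" "X \<in> Q" "P = add_to_block a Q X"
        using add_to_block_surj[OF assms(2) P(1)] by blast
      then show ?thesis
        using P card_add_to_block[OF assms] by (force simp: partitions_with_def)
    qed
  qed
  show "?R \<subseteq> ?L"
  proof -
    have "insert {a} P \<in> ?L" if "P \<in> partitions_with A k" for P
    proof -
      have P: "partition_on A P" "card P = k" using that by (auto simp: partitions_with_def)
      moreover have "{a} \<notin> P" using assms(2) P by (auto simp: partition_on_def)
      ultimately show ?thesis
        using finite_elements[OF assms(1) P(1)] partition_on_insert_singleton[OF assms(2) P(1)]
        by (simp add: partitions_with_def)
    qed
    moreover have "add_to_block a Q X \<in> ?L" if "Q \<in> partitions_with A (Suc k)" "X \<in> Q" for Q X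
      using that card_add_to_block[OF assms] partition_on_add_to_block[OF assms(2)]
      by (auto simp: partitions_with_def)
    ultimately show ?thesis by auto
  qed
qed

text \<open>Ties the recursively defined \<open>Stirling\<close> to actual partitions: both sides
  satisfy the same recurrence and agree on the base cases.\<close>

lemma card_partitions_with:
  assumes "finite A"
  shows "card (partitions_with A k) = Stirling (card A) k"
  using assms
proof (induction A arbitrary: k rule: finite_induct)
  case empty
  have "partitions_with ({} :: 'a set) k = (if k = 0 then {{}} else {})"
    by (auto simp: partitions_with_def partition_on_empty)
  then show ?case by (cases k) simp_all
next
  case (insert a A)
  show ?case
  proof (cases k)
    case 0
    \<comment> \<open>A nonempty set has no partition into zero blocks, matching
      \<open>Stirling (Suc n) 0 = 0\<close>.\<close>
    have "card P \<noteq> 0" if P: "partition_on (insert a A) P" for P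
    proof -
      have "finite P" using finite_elements[OF _ P] insert.hyps by simp
      moreover have "P \<noteq> {}" using P by (auto simp: partition_on_def)
      ultimately show ?thesis by simp
    qed
    then have "partitions_with (insert a A) 0 = {}" by (auto simp: partitions_with_def)
    then show ?thesis using 0 insert.hyps by simp
  next
    case (Suc k')
    let ?I = "insert {a} ` partitions_with A k'"
    let ?S = "SIGMA Q : partitions_with A (Suc k'). Q"
    let ?J = "(\<lambda>(Q, X). add_to_block a Q X) ` ?S"
    have notin: "{a} \<notin> P" if "partition_on A P" for P
      using that insert.hyps by (auto simp: partition_on_def)
    have fQ: "finite Q" "card Q = Suc k'" if "Q \<in> partitions_with A (Suc k')" for Q
      using that finite_elements[OF insert.hyps(1), of Q] by (auto simp: partitions_with_def)
    have finS: "finite ?S"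
      using finite_partitions_with[OF insert.hyps(1)] fQ by auto
    have "inj_on (insert {a}) (partitions_with A k')"
    proof (rule inj_onI)
      fix P Q assume "P \<in> partitions_with A k'" "Q \<in> partitions_with A k'" "insert {a} P = insert {a} Q"
      then show "P = Q" using insert_ident[of "{a}" P Q] notin by (simp add: partitions_with_def)
    qed
    then have cI: "card ?I = Stirling (card A) k'"
      by (simp add: card_image insert.IH)
    have "inj_on (\<lambda>(Q, X). add_to_block a Q X) ?S"
    proof (rule inj_onI, clarify)
      fix Q X R Y
      assume "Q \<in> partitions_with A (Suc k')" "X \<in> Q" "R \<in> partitions_with A (Suc k')" "Y \<in> R"
        "add_to_block a Q X = add_to_block a R Y"
      then show "Q = R \<and> X = Y"
        using add_to_block_inject[OF insert.hyps(2), of Q X R Y] by (simp add: partitions_with_def)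
    qed
    then have "card ?J = card ?S" by (rule card_image)
    \<comment> \<open>Each \<open>Q\<close> offers \<open>card Q = Suc k'\<close> blocks that
      \<open>a\<close> may join, which is the factor in the recurrence.\<close>
    also have "\<dots> = (\<Sum>Q \<in> partitions_with A (Suc k'). card Q)"
      using finite_partitions_with[OF insert.hyps(1)] fQ by (simp add: card_SigmaI)
    also have "\<dots> = Suc k' * Stirling (card A) (Suc k')"
      using fQ by (simp add: insert.IH)
    finally have cJ: "card ?J = Suc k' * Stirling (card A) (Suc k')" .
    \<comment> \<open>The two images are told apart by whether \<open>{a}\<close> is a block, so
      their cardinalities add.\<close>
    have "{a} \<notin> add_to_block a Q X" if "partition_on A Q" "X \<in> Q" for Q X
    proof -
      have "X \<noteq> {}" "a \<notin> X" using that insert.hyps(2) by (auto simp: partition_on_def)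
      then have "insert a X \<noteq> {a}" by blast
      then show ?thesis using notin[OF that(1)] by (simp add: add_to_block_def)
    qed
    then have "?I \<inter> ?J = {}"
      by (auto simp: partitions_with_def)
    then show ?thesis
      using finS finite_partitions_with[OF insert.hyps(1)] insert.hyps
      unfolding Suc partitions_with_insert_Suc[OF insert.hyps]
      by (simp add: card_Un_disjoint cI cJ)
  qed
qed

section \<open>Weighted sum over partitions, grouped by number of blocks\<close>

lemma sum_power_card_partitions:
  fixes x :: nat
  assumes "n \<ge> 1"
  shows "(\<Sum>P | partition_on {1..n} P. x ^ card P) = (\<Sum>k=1..n. x ^ k * Stirling n k)"
proof -
  let ?D = "{P. partition_on {1..n::nat} P}"
  have fin: "finite ?D" by (rule finitely_many_partition_on) simp
  have "card P \<in> {1..n}" if P: "partition_on {1..n} P" for P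
  proof -
    have fP: "finite P" using finite_elements[OF _ P] by simp
    \<comment> \<open>\<open>P\<close> itself is among the partitions counted by this number. As
      Stirling numbers vanish when there are more blocks than elements, this bounds
      \<open>card P\<close> by \<open>n\<close>.\<close>
    have "Stirling n (card P) \<noteq> 0"
    proof -
      have "P \<in> partitions_with {1..n} (card P)" using P by (simp add: partitions_with_def)
      then have "card (partitions_with {1..n} (card P)) \<noteq> 0"
        using finite_partitions_with[of "{1..n}" "card P"] by auto
      then show ?thesis by (simp add: card_partitions_with)
    qed
    moreover have "P \<noteq> {}" using P assms by (auto simp: partition_on_def)
    ultimately show ?thesis
      using fP Stirling_less[of n "card P"] by (cases "n < card P") (simp_all add: Suc_le_eq card_gt_0_iff)
  qed
  then have "(\<Sum>P\<in>?D. x ^ card P) =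
      (\<Sum>k=1..n. \<Sum>P | P \<in> ?D \<and> card P = k. x ^ card P)"
    by (intro sum.group[symmetric] fin) auto
  also have "\<dots> = (\<Sum>k=1..n. x ^ k * Stirling n k)"
  proof (rule sum.cong[OF refl])
    fix k
    show "(\<Sum>P | P \<in> ?D \<and> card P = k. x ^ card P) = x ^ k * Stirling n k"
      using card_partitions_with[of "{1..n}" k] by (simp add: partitions_with_def)
  qed
  finally show ?thesis .
qed

section \<open>Colorings with one free element per block\<close>

lemma card_color: "card (UNIV :: color set) = 2"
proof -
  have U: "(UNIV :: color set) = {Col_a, Col_b}" using color.exhaust by auto
  show ?thesis unfolding U by simp
qed

text \<open>Abstracts over the choice \<open>m\<close> of an element in each block, so that
  \<open>Max\<close> and \<open>Min\<close> share one count.\<close>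

lemma card_eq_avoiders_distinguished:
  assumes "n \<ge> 1"
    and m: "\<And>X. finite X \<Longrightarrow> X \<noteq> {} \<Longrightarrow> m X \<in> X"
    and avoid: "\<And>P c. partition_on {1..n} P \<Longrightarrow>
      (\<forall>r\<in>R. \<not> eq_contains (P, c) r) \<longleftrightarrow> (\<forall>X\<in>P. \<forall>x\<in>X. c x = Col_a \<longrightarrow> x = m X)"
  shows "card (eq_avoiders n R) = (\<Sum>k=1..n. 2 ^ k * Stirling n k)"
proof -
  \<comment> \<open>The admissible colorings of a fixed \<open>P\<close>, written as a dependent
    product so that \<open>card_PiE\<close> applies; its extensionality agrees with that of
    \<open>colored_partitions\<close>.\<close>
  define F where "F P = (\<Pi>\<^sub>E x\<in>{1..n}. if x \<in> m ` P then UNIV else {Col_b})" for P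
  have mem: "m X \<in> X" if "partition_on {1..n} P" "X \<in> P" for X P
  proof -
    have "X \<subseteq> {1..n}" "X \<noteq> {}" using that by (auto simp: partition_on_def)
    then show ?thesis using m finite_subset by blast
  qed
  have iff: "(\<forall>X\<in>P. \<forall>x\<in>X. c x = Col_a \<longrightarrow> x = m X) \<longleftrightarrow>
      (\<forall>x\<in>{1..n}. x \<notin> m ` P \<longrightarrow> c x = Col_b)" if P: "partition_on {1..n} P" for P c
  proof -
    have U: "\<Union>P = {1..n}" using P by (simp add: partition_on_def)
    \<comment> \<open>If \<open>x\<close> in \<open>X\<close> equals \<open>m Y\<close>, then
      \<open>x\<close> lies in both \<open>X\<close> and \<open>Y\<close>, so disjointness gives
      \<open>Y = X\<close>.\<close>
    have "x = m X \<longleftrightarrow> x \<in> m ` P" if "X \<in> P" "x \<in> X" for X x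
      using that mem[OF P] partition_on_disjointD[OF P] by blast
    moreover have "c x = Col_a \<longleftrightarrow> c x \<noteq> Col_b" for x by (cases "c x") auto
    ultimately show ?thesis unfolding U[symmetric] by blast
  qed
  have "eq_avoiders n R = (SIGMA P : {P. partition_on {1..n} P}. F P)"
  proof -
    have "c \<in> {1..n} \<rightarrow>\<^sub>E UNIV \<and> (\<forall>r\<in>R. \<not> eq_contains (P, c) r) \<longleftrightarrow> c \<in> F P"
      if "partition_on {1..n} P" for P c
      unfolding avoid[OF that] iff[OF that] F_def PiE_iff by auto
    then show ?thesis
      unfolding eq_avoiders_def colored_partitions_def by blast
  qed
  moreover have "card (F P) = 2 ^ card P" if P: "partition_on {1..n} P" for P
  proof -
    \<comment> \<open>Disjoint blocks have different distinguished elements, so the number of free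
      positions is exactly the number of blocks.\<close>
    have "inj_on m P"
      using mem[OF P] partition_on_disjointD[OF P] unfolding inj_on_def by metis
    then have c: "card (m ` P) = card P" by (rule card_image)
    have sub: "m ` P \<subseteq> {1..n}" using mem[OF P] P by (auto simp: partition_on_def)
    have "card (F P) = (\<Prod>x\<in>{1..n}. if x \<in> m ` P then 2 else 1)"
      unfolding F_def by (subst card_PiE) (auto intro!: prod.cong simp: card_color)
    also have "\<dots> = (\<Prod>x\<in>{1..n} \<inter> m ` P. 2)"
      by (rule prod.inter_restrict[symmetric]) simp
    also have "{1..n} \<inter> m ` P = m ` P" using sub by blast
    finally show ?thesis by (simp add: c)
  qed
  moreover have "finite (F P)" for P
  proof -
    have "finite (UNIV :: color set)" using card_color by (simp add: card_ge_0_finite)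
    then show ?thesis unfolding F_def by (intro finite_PiE) auto
  qed
  moreover have "finite {P. partition_on {1..n} P}"
    by (rule finitely_many_partition_on) simp
  ultimately have "card (eq_avoiders n R) = (\<Sum>P | partition_on {1..n} P. 2 ^ card P)"
    by (simp add: card_SigmaI)
  then show ?thesis by (simp only: sum_power_card_partitions[OF assms(1)])
qed

section \<open>The two pattern sets\<close>

lemma eq_avoid_any_after_a_iff:
  "(\<forall>r\<in>{(Col_a, Col_b), (Col_a, Col_a)}. \<not> eq_contains (P, c) r) \<longleftrightarrow>
    (\<forall>X\<in>P. \<forall>x\<in>X. c x = Col_a \<longrightarrow> (\<forall>y\<in>X. y \<le> x))"
proof -
  \<comment> \<open>The two patterns together allow either color for \<open>y\<close>, so only the
    color of \<open>x\<close> remains in the condition.\<close>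
  have "c y = Col_a \<or> c y = Col_b" for y by (cases "c y") auto
  then show ?thesis unfolding ball_simps eq_contains.simps not_less[symmetric] by blast
qed

text \<open>Here the shared \<open>Col_a\<close> is the second entry of both patterns, so it is the
  earlier element whose color is arbitrary and the order is reversed.\<close>

lemma eq_avoid_any_before_a_iff:
  "(\<forall>r\<in>{(Col_b, Col_a), (Col_a, Col_a)}. \<not> eq_contains (P, c) r) \<longleftrightarrow>
    (\<forall>X\<in>P. \<forall>x\<in>X. c x = Col_a \<longrightarrow> (\<forall>y\<in>X. x \<le> y))"
proof -
  have "c y = Col_a \<or> c y = Col_b" for y by (cases "c y") auto
  then show ?thesis unfolding ball_simps eq_contains.simps not_less[symmetric] by blast
qed

lemma finite_block:
  assumes "partition_on {1..n::nat} P" "X \<in> P"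
  shows "finite X"
proof (rule finite_subset)
  show "X \<subseteq> {1..n}" using assms by (auto simp: partition_on_def)
qed simp

theorem theorem3p4:
  fixes n :: nat
  assumes "n \<ge> 1"
  shows "card (eq_avoiders n {(Col_a, Col_b), (Col_a, Col_a)}) =
           card (eq_avoiders n {(Col_b, Col_a), (Col_a, Col_a)})
       \<and> card (eq_avoiders n {(Col_b, Col_a), (Col_a, Col_a)}) =
           (\<Sum>k=1..n. 2 ^ k * Stirling n k)"
proof -
  have "card (eq_avoiders n {(Col_a, Col_b), (Col_a, Col_a)}) = (\<Sum>k=1..n. 2 ^ k * Stirling n k)"
  proof (rule card_eq_avoiders_distinguished[OF assms, of Max])
    fix P c assume P: "partition_on {1..n} P"
    \<comment> \<open>Blocks are finite, so an element that bounds its block from above is its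
      \<open>Max\<close>, and conversely.\<close>
    have "(\<forall>y\<in>X. y \<le> x) \<longleftrightarrow> x = Max X" if "X \<in> P" "x \<in> X" for X x
      using finite_block[OF P that(1)] that(2) by (auto intro: Max_eqI[symmetric])
    then show "(\<forall>r\<in>{(Col_a, Col_b), (Col_a, Col_a)}. \<not> eq_contains (P, c) r) \<longleftrightarrow>
        (\<forall>X\<in>P. \<forall>x\<in>X. c x = Col_a \<longrightarrow> x = Max X)"
      unfolding eq_avoid_any_after_a_iff by (simp cong: ball_cong)
  qed simp
  moreover have "card (eq_avoiders n {(Col_b, Col_a), (Col_a, Col_a)}) =
      (\<Sum>k=1..n. 2 ^ k * Stirling n k)"
  proof (rule card_eq_avoiders_distinguished[OF assms, of Min])
    fix P c assume P: "partition_on {1..n} P"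
    have "(\<forall>y\<in>X. x \<le> y) \<longleftrightarrow> x = Min X" if "X \<in> P" "x \<in> X" for X x
      using finite_block[OF P that(1)] that(2) by (auto intro: Min_eqI[symmetric])
    then show "(\<forall>r\<in>{(Col_b, Col_a), (Col_a, Col_a)}. \<not> eq_contains (P, c) r) \<longleftrightarrow>
        (\<forall>X\<in>P. \<forall>x\<in>X. c x = Col_a \<longrightarrow> x = Min X)"
      unfolding eq_avoid_any_before_a_iff by (simp cong: ball_cong)
  qed simp
  ultimately show ?thesis by simp
qed

end
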